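(* Let $F\colon \mathbb{R}^n\rightrightarrows \mathbb{R}^m$ be a set-valued mapping with closed graph, and let $\overline{y} \in J(F)$. Then the following conditions are equivalent: (i) (coderivative nonsingularity) $\mathrm{ker}\,D^*F (\infty, \overline{y}) = \{0\}$. (ii) (linear openness at infinity) There exist constants $R > 0$, $\mu > 0$, $\epsilon > 0$ and a neighborhood $V$ of $\overline{y}$ in $\mathbb{R}^m$ such that $$\big(F(x) + \mu r \mathbb{B} \big) \cap V \subset F(x+r\mathbb{B}) \quad \text{whenever } x \in \mathbb{R}^n \setminus \mathbb{B}_R \text{ and } r \in (0, \epsilon).$$ (iii) (metric regularity at infinity) There are constants $R > 0$, $\ell> 0$, $\gamma > 0$ and a neighborhood $V$ of $\overline{y}$ in $\mathbb{R}^m$ such that $$\mathrm{dist}(x, F^{-1}(y)) \leq \ell\, \mathrm{dist}(y, F(x))$$ for all $x \in \mathbb{R}^n \setminus \mathbb{B}_{R}$ and $y \in V$ with $\mathrm{dist}(y, F(x)) < \gamma$. (iv) (inverse Lipschitz-like property at infinity) There are constants $R > 0$, $\ell > 0$ and a neighborhood $V$ of $\overline{y}$ in $\mathbb{R}^m$ such that $$F^{-1}(y') \cap \big( \mathbb{R}^n \setminus \mathbb{B}_{R}\big) \subset F^{-1}(y) + \ell\|y' - y\|\mathbb{B} \quad \text{for all } y', y \in V.$$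
   Context: All spaces $\mathbb{R}^n$ carry the Euclidean norm; $\mathbb{B}_r$ is the closed ball of radius $r$ centered at the origin and $\mathbb{B}=\mathbb{B}_1$. For $F\colon \mathbb{R}^n \rightrightarrows \mathbb{R}^m$: $\mathrm{gph}\,F := \{(x,y) : y\in F(x)\}$, $\mathrm{ker}\,F := \{x : 0\in F(x)\}$, $F^{-1}(y) := \{x : y\in F(x)\}$, and $F(A):=\bigcup_{x\in A}F(x)$. $\mathrm{dist}(x,\Omega):=\inf_{y\in\Omega}\|x-y\|$, with $\mathrm{dist}(x,\emptyset)=+\infty$. Jelonek set: $J(F)$ is the set of $y\in\mathbb{R}^m$ for which there exist $(x_k,y_k)\in \mathrm{gph}\,F$ with $\|x_k\|\to\infty$ and $y_k\to y$. Regular normal cone: for $\Omega\subset\mathbb{R}^N$ and $z\in\Omega$, $\widehat{N}_\Omega(z)$ is the set of $\xi\in\mathbb{R}^N$ with $\langle \xi, z'-z\rangle\le o(\|z'-z\|)$ as $z'\to z$, $z'\in\Omega$. Normal cone at infinity: for $\Omega\subset\mathbb{R}^n\times\mathbb{R}^m$ and $\overline{y}\in\mathbb{R}^m$, $N_\Omega(\infty,\overline{y})$ is the set of all $\xi$ for which there exist $(x_k,y_k)\in\Omega$ with $\|x_k\|\to\infty$, $y_k\to\overline{y}$, and $\xi_k\in\widehat{N}_\Omega(x_k,y_k)$ with $\xi_k\to\xi$. Coderivative at infinity: for $\overline{y}\in J(F)$, $D^*F(\infty,\overline{y})\colon\mathbb{R}^m\rightrightarrows\mathbb{R}^n$, $D^*F(\infty,\overline{y})(v)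 := \{u\in\mathbb{R}^n : (u,-v)\in N_{\mathrm{gph}\,F}(\infty,\overline{y})\}$. *)

theory Defs
  imports "HOL-Analysis.Analysis" "HOL-Library.Set_Algebras" "HOL-Library.Landau_Symbols"
begin

text \<open>Set-valued mappings are functions \<open>F :: 'a \<Rightarrow> 'b set\<close>; the product type carries the
  Euclidean norm and inner product, and Minkowski sums are written with \<open>+\<close> on sets.\<close>

definition gph :: "('a \<Rightarrow> 'b set) \<Rightarrow> ('a \<times> 'b) set" where
  "gph F = {(x, y). y \<in> F x}"

definition ker :: "('a \<Rightarrow> 'b::zero set) \<Rightarrow> 'a set" where
  "ker F = {x. 0 \<in> F x}"

definition sv_inv :: "('a \<Rightarrow> 'b set) \<Rightarrow> 'b \<Rightarrow> 'a set" where
  "sv_inv F y = {x. y \<in> F x}"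

definition sv_image :: "('a \<Rightarrow> 'b set) \<Rightarrow> 'a set \<Rightarrow> 'b set" where
  "sv_image F A = (\<Union>x\<in>A. F x)"

text \<open>Extended-real valued, so that the distance to the empty set is \<open>\<infinity>\<close>
  (the library's \<open>infdist\<close> is 0 there).\<close>

definition edist_set :: "'a::metric_space \<Rightarrow> 'a set \<Rightarrow> ereal" where
  "edist_set x S = (INF y\<in>S. ereal (dist x y))"

definition jelonek_set :: "('a::real_normed_vector \<Rightarrow> 'b::real_normed_vector set) \<Rightarrow> 'b set" where
  "jelonek_set F = {y. \<exists>xs ys. (\<forall>k::nat. (xs k, ys k) \<in> gph F) \<and>
     filterlim (\<lambda>k. norm (xs k)) at_top sequentially \<and> ys \<longlonglongrightarrow> y}"

definition regular_normal_cone :: "'a::real_inner set \<Rightarrow> 'a \<Rightarrow> 'a set" where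
  "regular_normal_cone \<Omega> z = {\<xi>. \<exists>h \<in> o[at z within \<Omega>](\<lambda>z'. norm (z' - z)).
     \<forall>\<^sub>F z' in at z within \<Omega>. \<xi> \<bullet> (z' - z) \<le> h z'}"

definition normal_cone_at_infinity ::
  "('a::real_inner \<times> 'b::real_inner) set \<Rightarrow> 'b \<Rightarrow> ('a \<times> 'b) set" where
  "normal_cone_at_infinity \<Omega> ybar = {\<xi>. \<exists>xs ys \<xi>s.
     (\<forall>k::nat. (xs k, ys k) \<in> \<Omega> \<and> \<xi>s k \<in> regular_normal_cone \<Omega> (xs k, ys k)) \<and>
     filterlim (\<lambda>k. norm (xs k)) at_top sequentially \<and> ys \<longlonglongrightarrow> ybar \<and> \<xi>s \<longlonglongrightarrow> \<xi>}"

definition coderivative_at_infinity ::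
  "('a::real_inner \<Rightarrow> 'b::real_inner set) \<Rightarrow> 'b \<Rightarrow> 'b \<Rightarrow> 'a set" where
  "coderivative_at_infinity F ybar v = {u. (u, - v) \<in> normal_cone_at_infinity (gph F) ybar}"

text \<open>Below, a neighborhood of \<open>ybar\<close> is any set having \<open>ybar\<close> in its interior, and
  \<open>cball 0 r\<close> is \<open>r\<close> times the closed unit ball.\<close>

definition linearly_open_at_infinity ::
  "('a::real_normed_vector \<Rightarrow> 'b::real_normed_vector set) \<Rightarrow> 'b \<Rightarrow> bool" where
  "linearly_open_at_infinity F ybar \<longleftrightarrow>
     (\<exists>R \<mu> \<epsilon> V. R > 0 \<and> \<mu> > 0 \<and> \<epsilon> > 0 \<and> ybar \<in> interior V \<and>
        (\<forall>x r. x \<in> - cball 0 R \<and> r \<in> {0<..<\<epsilon>} \<longrightarrow>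
           (F x + cball 0 (\<mu> * r)) \<inter> V \<subseteq> sv_image F ({x} + cball 0 r)))"

definition metrically_regular_at_infinity ::
  "('a::real_normed_vector \<Rightarrow> 'b::real_normed_vector set) \<Rightarrow> 'b \<Rightarrow> bool" where
  "metrically_regular_at_infinity F ybar \<longleftrightarrow>
     (\<exists>R l \<gamma> V. R > 0 \<and> l > 0 \<and> \<gamma> > 0 \<and> ybar \<in> interior V \<and>
        (\<forall>x y. x \<in> - cball 0 R \<and> y \<in> V \<and> edist_set y (F x) < ereal \<gamma> \<longrightarrow>
           edist_set x (sv_inv F y) \<le> ereal l * edist_set y (F x)))"

definition inverse_Lipschitz_like_at_infinity ::
  "('a::real_normed_vector \<Rightarrow> 'b::real_normed_vector set) \<Rightarrow> 'b \<Rightarrow> bool" where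
  "inverse_Lipschitz_like_at_infinity F ybar \<longleftrightarrow>
     (\<exists>R l V. R > 0 \<and> l > 0 \<and> ybar \<in> interior V \<and>
        (\<forall>y'\<in>V. \<forall>y\<in>V.
           sv_inv F y' \<inter> (- cball 0 R) \<subseteq> sv_inv F y + cball 0 (l * norm (y' - y))))"

end

theory Submission
  imports Defs
begin

text \<open>
  All four properties are compared with one estimate on the regular normals of the graph:
  there is a constant \<open>c\<close> such that every regular normal \<open>(u, w)\<close> at a graph point \<open>(x, y)\<close>
  with \<open>x\<close> far out and \<open>y\<close> near \<open>ybar\<close> satisfies \<open>norm w \<le> c * norm u\<close>.

  The three covering properties (ii), (iii) and (iv) all say that a graph point \<open>(x, y')\<close> with
  \<open>x\<close> far out can be moved to a graph point \<open>(x', y)\<close> at a cost \<open>dist x' x \<le> l * dist y y'\<close>.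
  They differ in which of the quantities is prescribed, and closedness of the graph makes
  the distances in (iii) attained, so passing between them only adjusts radii and constants.

  Coderivative nonsingularity gives the estimate by compactness: normals that violate it with
  constants tending to infinity can be scaled to \<open>norm w = 1\<close>, which forces \<open>u \<rightarrow> 0\<close>, and a
  limit of the \<open>w\<close> is a nonzero element of the kernel.  Conversely, the estimate passes to the
  limit and shows that normals at infinity of the form \<open>(0, w)\<close> vanish.

  The estimate gives (iv) by a variational argument.  Given a far graph point \<open>(x, y')\<close> and a
  target \<open>y\<close>, minimise \<open>dist z y + \<alpha> * (dist a x)\<^sup>2\<close> over the graph.  If the minimiser
  \<open>(a, b)\<close> had \<open>b \<noteq> y\<close>, the cost would be differentiable there and minus its gradient would be
  a regular normal whose second component is a unit vector and whose first component is short
  when \<open>\<alpha>\<close> is suitable; this contradicts the estimate.  So \<open>b = y\<close>, and minimality bounds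
  \<open>dist a x\<close>.  Minimisers exist because closed bounded sets are compact, and squaring the
  distance in the penalty keeps it smooth at \<open>a = x\<close>.

  In the other direction, (iv) moves a graph point \<open>(x, y)\<close> in the direction \<open>w\<close> of a regular
  normal \<open>(u, w)\<close> at a controlled cost in \<open>x\<close>, and the definition of a regular normal turns this
  into the estimate.
\<close>

section \<open>Distances and Minkowski sums\<close>

lemma mem_set_plus_cball_iff:
  fixes S :: "'a::real_normed_vector set"
  shows "z \<in> S + cball 0 e \<longleftrightarrow> (\<exists>s\<in>S. dist z s \<le> e)"
proof
  assume "z \<in> S + cball 0 e"
  then obtain s b where "s \<in> S" "norm b \<le> e" "z = s + b"
    by (auto simp: set_plus_def)
  then show "\<exists>s\<in>S. dist z s \<le> e"
    by (intro bexI[of _ s]) (auto simp: dist_norm)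
next
  assume "\<exists>s\<in>S. dist z s \<le> e"
  then obtain s where s: "s \<in> S" "dist z s \<le> e" by blast
  then have "s + (z - s) \<in> S + cball 0 e"
    by (intro set_plus_intro) (auto simp: dist_norm norm_minus_commute)
  then show "z \<in> S + cball 0 e" by simp
qed

lemma edist_set_le: "y \<in> S \<Longrightarrow> edist_set x S \<le> ereal (dist x y)"
  unfolding edist_set_def by (rule INF_lower)

lemma edist_set_attained:
  fixes S :: "'a::heine_borel set"
  assumes "closed S" and "edist_set x S < \<infinity>"
  obtains y where "y \<in> S" "edist_set x S = ereal (dist x y)"
proof -
  have "S \<noteq> {}" using assms(2) by (auto simp: edist_set_def top_ereal_def)
  then obtain y where y: "y \<in> S" "\<And>z. z \<in> S \<Longrightarrow> dist x y \<le> dist x z"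
    using distance_attains_inf[OF assms(1)] by metis
  then have "ereal (dist x y) \<le> edist_set x S"
    unfolding edist_set_def by (intro INF_greatest) auto
  then show thesis using that y(1) edist_set_le[OF y(1)] by (metis antisym)
qed

lemma closed_value:
  assumes "closed (gph F)"
  shows "closed (F x)"
proof -
  have "F x = Pair x -` gph F" by (auto simp: gph_def)
  then show ?thesis by (simp add: assms closed_vimage continuous_on_Pair)
qed

lemma closed_sv_inv:
  assumes "closed (gph F)"
  shows "closed (sv_inv F y)"
proof -
  have "sv_inv F y = (\<lambda>x. (x, y)) -` gph F" by (auto simp: gph_def sv_inv_def)
  then show ?thesis by (simp add: assms closed_vimage continuous_on_Pair)
qed

section \<open>The covering properties\<close>

text \<open>The arbitrary neighbourhood is traded for a ball and the set inclusion for the motion of a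
  single graph point; the other covering properties are compared with this form.\<close>

lemma inverse_Lipschitz_like_at_infinity_iff_ball:
  "inverse_Lipschitz_like_at_infinity F ybar \<longleftrightarrow>
     (\<exists>R l \<delta>. R > 0 \<and> l > 0 \<and> \<delta> > 0 \<and>
        (\<forall>x y y'. norm x > R \<and> y' \<in> F x \<and> dist y' ybar < \<delta> \<and> dist y ybar < \<delta> \<longrightarrow>
           (\<exists>x'. y \<in> F x' \<and> dist x x' \<le> l * dist y' y)))"
  (is "?L \<longleftrightarrow> ?P")
proof
  assume ?L
  then obtain R l V where *: "R > 0" "l > 0" "ybar \<in> interior V"
    and V: "\<And>y' y. y' \<in> V \<Longrightarrow> y \<in> V \<Longrightarrow>
      sv_inv F y' \<inter> (- cball 0 R) \<subseteq> sv_inv F y + cball 0 (l * norm (y' - y))"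
    unfolding inverse_Lipschitz_like_at_infinity_def by blast
  obtain \<delta> where \<delta>: "\<delta> > 0" "ball ybar \<delta> \<subseteq> V"
    using *(3) by (auto simp: mem_interior)
  have "\<exists>x'. y \<in> F x' \<and> dist x x' \<le> l * dist y' y"
    if "norm x > R" "y' \<in> F x" "dist y' ybar < \<delta>" "dist y ybar < \<delta>" for x y y'
  proof -
    have "y' \<in> V" "y \<in> V" using that \<delta>(2) by (auto simp: dist_commute)
    moreover have "x \<in> sv_inv F y' \<inter> (- cball 0 R)" using that by (auto simp: sv_inv_def)
    ultimately have "x \<in> sv_inv F y + cball 0 (l * norm (y' - y))" using V by blast
    then show ?thesis by (auto simp: mem_set_plus_cball_iff sv_inv_def dist_norm)
  qed
  then show ?P using * \<delta>(1) by blast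
next
  assume ?P
  then obtain R l \<delta> where *: "R > 0" "l > 0" "\<delta> > 0"
    and P: "\<And>x y y'. norm x > R \<Longrightarrow> y' \<in> F x \<Longrightarrow> dist y' ybar < \<delta> \<Longrightarrow> dist y ybar < \<delta> \<Longrightarrow>
           (\<exists>x'. y \<in> F x' \<and> dist x x' \<le> l * dist y' y)"
    by metis
  have "sv_inv F y' \<inter> (- cball 0 R) \<subseteq> sv_inv F y + cball 0 (l * norm (y' - y))"
    if "y' \<in> ball ybar \<delta>" "y \<in> ball ybar \<delta>" for y y'
    using that P[of _ y' y]
    by (auto simp: mem_set_plus_cball_iff sv_inv_def dist_norm norm_minus_commute not_le)
  moreover have "ybar \<in> interior (ball ybar \<delta>)" using *(3) by simp
  ultimately show ?L using *(1,2) unfolding inverse_Lipschitz_like_at_infinity_def by blast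
qed

text \<open>The radius \<open>r\<close> in linear openness and the displacement \<open>dist y' y\<close> determine each other
  through \<open>r = dist y' y / \<mu>\<close>; shrinking the ball around \<open>ybar\<close> keeps \<open>r\<close> below \<open>\<epsilon>\<close>, or the
  starting value \<open>y'\<close> near \<open>ybar\<close>.\<close>

lemma linearly_open_iff_inverse_Lipschitz_like:
  "linearly_open_at_infinity F ybar \<longleftrightarrow> inverse_Lipschitz_like_at_infinity F ybar"
proof
  assume "linearly_open_at_infinity F ybar"
  then obtain R \<mu> \<epsilon> V where *: "R > 0" "\<mu> > 0" "\<epsilon> > 0" "ybar \<in> interior V"
    and open': "\<And>x r. x \<in> - cball 0 R \<Longrightarrow> r \<in> {0<..<\<epsilon>} \<Longrightarrow>
        (F x + cball 0 (\<mu> * r)) \<inter> V \<subseteq> sv_image F ({x} + cball 0 r)"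
    unfolding linearly_open_at_infinity_def by blast
  obtain d where d: "d > 0" "ball ybar d \<subseteq> V"
    using *(4) by (auto simp: mem_interior)
  define \<delta> where "\<delta> = min d (\<mu> * \<epsilon> / 2)"
  have \<delta>: "\<delta> > 0" "\<delta> \<le> d" "2 * \<delta> \<le> \<mu> * \<epsilon>" using * d by (auto simp: \<delta>_def)
  have "\<exists>x'. y \<in> F x' \<and> dist x x' \<le> (1 / \<mu>) * dist y' y"
    if x: "norm x > R" "y' \<in> F x" "dist y' ybar < \<delta>" "dist y ybar < \<delta>" for x y y'
  proof (cases "y' = y")
    case True
    then show ?thesis using x by (intro exI[of _ x]) auto
  next
    case False
    define r where "r = dist y' y / \<mu>"
    have "dist y' y < 2 * \<delta>" using dist_triangle2[of y' y ybar] x by linarith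
    then have "dist y' y < \<mu> * \<epsilon>" using \<delta> by linarith
    then have r: "r \<in> {0<..<\<epsilon>}" using False *(2)
      by (auto simp: r_def divide_less_eq mult.commute)
    have "y \<in> F x + cball 0 (\<mu> * r)"
      using x(2) *(2) by (auto simp: mem_set_plus_cball_iff r_def dist_commute)
    moreover have "y \<in> V" using x(4) \<delta>(2) d(2) by (auto simp: dist_commute)
    ultimately have "y \<in> sv_image F ({x} + cball 0 r)" using open'[of x r] x(1) r by auto
    then show ?thesis
      by (auto simp: sv_image_def mem_set_plus_cball_iff r_def dist_commute)
  qed
  then show "inverse_Lipschitz_like_at_infinity F ybar"
    unfolding inverse_Lipschitz_like_at_infinity_iff_ball using *(1,2) \<delta>(1)
    by (intro exI[of _ R] exI[of _ "1 / \<mu>"] exI[of _ \<delta>]) auto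
next
  assume "inverse_Lipschitz_like_at_infinity F ybar"
  then obtain R l \<delta> where *: "R > 0" "l > 0" "\<delta> > 0"
    and P: "\<And>x y y'. norm x > R \<Longrightarrow> y' \<in> F x \<Longrightarrow> dist y' ybar < \<delta> \<Longrightarrow> dist y ybar < \<delta> \<Longrightarrow>
           (\<exists>x'. y \<in> F x' \<and> dist x x' \<le> l * dist y' y)"
    unfolding inverse_Lipschitz_like_at_infinity_iff_ball by metis
  have "y \<in> sv_image F ({x} + cball 0 r)"
    if x: "norm x > R" and r: "0 < r" "r < l * \<delta> / 2"
      and y: "y \<in> F x + cball 0 (1 / l * r)" "y \<in> ball ybar (\<delta> / 2)" for x r y
  proof -
    obtain y' where y': "y' \<in> F x" "dist y' y \<le> r / l"
      using y(1) by (auto simp: mem_set_plus_cball_iff dist_commute)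
    have "r / l < \<delta> / 2" using r *(2) by (auto simp: field_simps)
    moreover have "dist y ybar < \<delta> / 2" using y(2) by (simp add: dist_commute)
    ultimately have "dist y' ybar < \<delta>" "dist y ybar < \<delta>"
      using dist_triangle[of y' ybar y] y'(2) *(3) by linarith+
    then obtain x' where "y \<in> F x'" "dist x x' \<le> l * dist y' y" using P[OF x y'(1)] by blast
    moreover have "l * dist y' y \<le> r" using y'(2) *(2) by (auto simp: field_simps)
    ultimately show ?thesis
      by (fastforce simp: sv_image_def mem_set_plus_cball_iff dist_commute)
  qed
  then show "linearly_open_at_infinity F ybar"
    unfolding linearly_open_at_infinity_def using *
    by (intro exI[of _ R] exI[of _ "1 / l"] exI[of _ "l * \<delta> / 2"] exI[of _ "ball ybar (\<delta> / 2)"])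
       (auto simp: not_le)
qed

text \<open>Closedness of the graph makes both distances attained, so the inequality between them is a
  statement about a nearest value \<open>y' \<in> F x\<close> and a nearest solution \<open>x'\<close> of \<open>y \<in> F x'\<close>.\<close>

lemma metrically_regular_iff_inverse_Lipschitz_like:
  fixes F :: "'a::{real_normed_vector,heine_borel} \<Rightarrow> 'b::{real_normed_vector,heine_borel} set"
  assumes cl: "closed (gph F)"
  shows "metrically_regular_at_infinity F ybar \<longleftrightarrow> inverse_Lipschitz_like_at_infinity F ybar"
proof
  assume "metrically_regular_at_infinity F ybar"
  then obtain R l \<gamma> V where *: "R > 0" "l > 0" "\<gamma> > 0" "ybar \<in> interior V"
    and reg: "\<And>x y. x \<in> - cball 0 R \<Longrightarrow> y \<in> V \<Longrightarrow> edist_set y (F x) < ereal \<gamma> \<Longrightarrow>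
           edist_set x (sv_inv F y) \<le> ereal l * edist_set y (F x)"
    unfolding metrically_regular_at_infinity_def by blast
  obtain d where d: "d > 0" "ball ybar d \<subseteq> V"
    using *(4) by (auto simp: mem_interior)
  define \<delta> where "\<delta> = min d (\<gamma> / 2)"
  have \<delta>: "\<delta> > 0" "\<delta> \<le> d" "2 * \<delta> \<le> \<gamma>" using * d by (auto simp: \<delta>_def)
  have "\<exists>x'. y \<in> F x' \<and> dist x x' \<le> l * dist y' y"
    if x: "norm x > R" "y' \<in> F x" "dist y' ybar < \<delta>" "dist y ybar < \<delta>" for x y y'
  proof -
    have le: "edist_set y (F x) \<le> ereal (dist y' y)"
      using edist_set_le[OF x(2), of y] by (simp add: dist_commute)
    have "dist y' y < \<gamma>" using dist_triangle2[of y' y ybar] x \<delta> by linarith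
    with le have "edist_set y (F x) < ereal \<gamma>" by (meson ereal_less_eq(3) le_less_trans less_ereal.simps(1))
    moreover have "y \<in> V" using x(4) \<delta>(2) d(2) by (auto simp: dist_commute)
    ultimately have "edist_set x (sv_inv F y) \<le> ereal l * edist_set y (F x)"
      using reg[of x y] x(1) by auto
    also have "\<dots> \<le> ereal l * ereal (dist y' y)"
      using le *(2) by (intro ereal_mult_left_mono) auto
    finally have b: "edist_set x (sv_inv F y) \<le> ereal (l * dist y' y)" by simp
    then have "edist_set x (sv_inv F y) < \<infinity>" by (rule le_less_trans) simp
    then obtain x' where "x' \<in> sv_inv F y" "edist_set x (sv_inv F y) = ereal (dist x x')"
      using edist_set_attained[OF closed_sv_inv[OF cl]] by metis
    then show ?thesis using b by (auto simp: sv_inv_def)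
  qed
  then show "inverse_Lipschitz_like_at_infinity F ybar"
    unfolding inverse_Lipschitz_like_at_infinity_iff_ball using *(1,2) \<delta>(1) by blast
next
  assume "inverse_Lipschitz_like_at_infinity F ybar"
  then obtain R l \<delta> where *: "R > 0" "l > 0" "\<delta> > 0"
    and P: "\<And>x y y'. norm x > R \<Longrightarrow> y' \<in> F x \<Longrightarrow> dist y' ybar < \<delta> \<Longrightarrow> dist y ybar < \<delta> \<Longrightarrow>
           (\<exists>x'. y \<in> F x' \<and> dist x x' \<le> l * dist y' y)"
    unfolding inverse_Lipschitz_like_at_infinity_iff_ball by metis
  have "edist_set x (sv_inv F y) \<le> ereal l * edist_set y (F x)"
    if x: "norm x > R" and y: "y \<in> ball ybar (\<delta> / 2)" "edist_set y (F x) < ereal (\<delta> / 2)" for x y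
  proof -
    have "edist_set y (F x) < \<infinity>" using y(2) by (rule less_trans) simp
    then obtain y' where y': "y' \<in> F x" "edist_set y (F x) = ereal (dist y y')"
      using edist_set_attained[OF closed_value[OF cl]] by metis
    then have "dist y y' < \<delta> / 2" using y(2) by simp
    then have "dist y' ybar < \<delta>" "dist y ybar < \<delta>"
      using dist_triangle3[of y' ybar y] y(1) *(3) by (auto simp: dist_commute)
    then obtain x' where x': "y \<in> F x'" "dist x x' \<le> l * dist y' y" using P[OF x y'(1)] by blast
    have "edist_set x (sv_inv F y) \<le> ereal (dist x x')"
      using x'(1) by (intro edist_set_le) (auto simp: sv_inv_def)
    also have "\<dots> \<le> ereal l * edist_set y (F x)"
      using x'(2) y'(2) by (simp add: dist_commute)
    finally show ?thesis .
  qed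
  then show "metrically_regular_at_infinity F ybar"
    unfolding metrically_regular_at_infinity_def using *
    by (intro exI[of _ R] exI[of _ l] exI[of _ "\<delta> / 2"] exI[of _ "ball ybar (\<delta> / 2)"])
       (auto simp: not_le)
qed

section \<open>Regular normals\<close>

lemma regular_normal_cone_le:
  assumes "\<xi> \<in> regular_normal_cone \<Omega> z" and "e > 0"
  obtains d where "d > 0"
    "\<And>z'. z' \<in> \<Omega> \<Longrightarrow> dist z' z < d \<Longrightarrow> \<xi> \<bullet> (z' - z) \<le> e * norm (z' - z)"
proof -
  obtain h where h: "h \<in> o[at z within \<Omega>](\<lambda>z'. norm (z' - z))"
    "\<forall>\<^sub>F z' in at z within \<Omega>. \<xi> \<bullet> (z' - z) \<le> h z'"
    using assms(1) unfolding regular_normal_cone_def by blast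
  have "\<forall>\<^sub>F z' in at z within \<Omega>. norm (h z') \<le> e * norm (norm (z' - z))"
    using landau_o.smallD[OF h(1) assms(2)] .
  with h(2) have "\<forall>\<^sub>F z' in at z within \<Omega>. \<xi> \<bullet> (z' - z) \<le> e * norm (z' - z)"
    by eventually_elim auto
  then obtain d where d: "d > 0"
    "\<And>z'. z' \<in> \<Omega> \<Longrightarrow> z' \<noteq> z \<Longrightarrow> dist z' z < d \<Longrightarrow> \<xi> \<bullet> (z' - z) \<le> e * norm (z' - z)"
    unfolding eventually_at by blast
  show thesis
  proof (rule that[OF d(1)])
    show "\<xi> \<bullet> (z' - z) \<le> e * norm (z' - z)" if "z' \<in> \<Omega>" "dist z' z < d" for z'
      using that d(2)[of z'] by (cases "z' = z") auto
  qed
qed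

lemma zero_in_regular_normal_cone: "0 \<in> regular_normal_cone \<Omega> z"
  unfolding regular_normal_cone_def by (auto intro!: bexI[of _ "\<lambda>_. 0"])

lemma scaleR_in_regular_normal_cone:
  assumes "\<xi> \<in> regular_normal_cone \<Omega> z" and "t \<ge> 0"
  shows "t *\<^sub>R \<xi> \<in> regular_normal_cone \<Omega> z"
proof -
  obtain h where h: "h \<in> o[at z within \<Omega>](\<lambda>z'. norm (z' - z))"
    "\<forall>\<^sub>F z' in at z within \<Omega>. \<xi> \<bullet> (z' - z) \<le> h z'"
    using assms(1) unfolding regular_normal_cone_def by blast
  have "(\<lambda>z'. t * h z') \<in> o[at z within \<Omega>](\<lambda>z'. norm (z' - z))"
    using h(1) by (cases "t = 0") auto
  moreover have "\<forall>\<^sub>F z' in at z within \<Omega>. (t *\<^sub>R \<xi>) \<bullet> (z' - z) \<le> t * h z'"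
    using h(2) by eventually_elim (simp add: assms(2) mult_left_mono)
  ultimately show ?thesis
    unfolding regular_normal_cone_def by (intro CollectI bexI[of _ "\<lambda>z'. t * h z'"])
qed

text \<open>Fermat's rule: at a minimiser over \<open>\<Omega>\<close> the first-order expansion of the objective has
  nonnegative increments, so its remainder is itself the little-o function that the definition of
  a regular normal asks for.\<close>

lemma minus_gradient_in_regular_normal_cone:
  fixes \<phi> :: "'a::real_inner \<Rightarrow> real"
  assumes der: "(\<phi> has_derivative (\<lambda>v. g \<bullet> v)) (at z)"
    and min: "\<And>z'. z' \<in> \<Omega> \<Longrightarrow> \<phi> z \<le> \<phi> z'"
  shows "- g \<in> regular_normal_cone \<Omega> z"
proof -
  define h where "h = (\<lambda>z'. \<phi> z' - \<phi> z - g \<bullet> (z' - z))"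
  have "((\<lambda>z'. norm (h z') / norm (z' - z)) \<longlongrightarrow> 0) (at z within \<Omega>)"
    using has_derivative_at_withinI[OF der, of \<Omega>] unfolding has_derivative_iff_norm h_def by blast
  then have "((\<lambda>z'. h z' / norm (z' - z)) \<longlongrightarrow> 0) (at z within \<Omega>)"
    by (subst (asm) tendsto_norm_zero_iff[symmetric]) (auto intro: tendsto_norm_zero_cancel)
  then have "h \<in> o[at z within \<Omega>](\<lambda>z'. norm (z' - z))"
    by (rule smalloI_tendsto) (auto simp: eventually_at intro!: exI[of _ 1])
  moreover have "\<forall>\<^sub>F z' in at z within \<Omega>. (- g) \<bullet> (z' - z) \<le> h z'"
    using min by (auto simp: eventually_at h_def intro!: exI[of _ 1])
  ultimately show ?thesis unfolding regular_normal_cone_def by blast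
qed

section \<open>The estimate on regular normals at infinity\<close>

definition regular_normals_bounded_at_infinity ::
  "('a::real_inner \<Rightarrow> 'b::real_inner set) \<Rightarrow> 'b \<Rightarrow> bool" where
  "regular_normals_bounded_at_infinity F ybar \<longleftrightarrow>
     (\<exists>R c \<delta>. R > 0 \<and> c > 0 \<and> \<delta> > 0 \<and>
        (\<forall>x y u w. y \<in> F x \<and> norm x > R \<and> dist y ybar < \<delta> \<and>
           (u, w) \<in> regular_normal_cone (gph F) (x, y) \<longrightarrow> norm w \<le> c * norm u))"

text \<open>For \<open>ybar\<close> outside the Jelonek set there are no normals at infinity and the kernel is empty;
  membership supplies graph points at which the zero normal can be placed, so that \<open>0\<close> is in the
  kernel.\<close>

lemma ker_coderivative_eq_zero_iff:
  fixes F :: "'a::real_inner \<Rightarrow> 'b::real_inner set"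
  assumes "ybar \<in> jelonek_set F"
  shows "ker (coderivative_at_infinity F ybar) = {0} \<longleftrightarrow>
    (\<forall>w. (0, w) \<in> normal_cone_at_infinity (gph F) ybar \<longrightarrow> w = 0)"
proof -
  obtain xs ys where "\<forall>k::nat. (xs k, ys k) \<in> gph F"
    "filterlim (\<lambda>k. norm (xs k)) at_top sequentially" "ys \<longlonglongrightarrow> ybar"
    using assms unfolding jelonek_set_def by blast
  moreover have "(0, 0) \<in> regular_normal_cone (gph F) (xs k, ys k)" for k
    using zero_in_regular_normal_cone[of "gph F" "(xs k, ys k)"] by (simp add: zero_prod_def)
  ultimately have zero: "(0, 0) \<in> normal_cone_at_infinity (gph F) ybar"
    unfolding normal_cone_at_infinity_def
    by (intro CollectI exI[of _ xs] exI[of _ ys] exI[of _ "\<lambda>_. (0, 0)"] conjI allI)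
       simp_all
  have "ker (coderivative_at_infinity F ybar) =
      {v. (0, - v) \<in> normal_cone_at_infinity (gph F) ybar}"
    by (simp add: ker_def coderivative_at_infinity_def)
  also have "\<dots> = {0} \<longleftrightarrow> (\<forall>v. (0, - v) \<in> normal_cone_at_infinity (gph F) ybar \<longrightarrow> v = 0)"
    using zero by fastforce
  also have "\<dots> \<longleftrightarrow> (\<forall>w. (0, w) \<in> normal_cone_at_infinity (gph F) ybar \<longrightarrow> w = 0)"
    by (metis minus_minus neg_equal_0_iff_equal)
  finally show ?thesis .
qed

lemma ker_coderivative_zero_if_regular_normals_bounded:
  assumes "regular_normals_bounded_at_infinity F ybar"
    and "(0, w) \<in> normal_cone_at_infinity (gph F) ybar"
  shows "w = 0"
proof -
  obtain R c \<delta> where *: "\<delta> > 0"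
    and bd: "\<And>x y u w. y \<in> F x \<Longrightarrow> norm x > R \<Longrightarrow> dist y ybar < \<delta> \<Longrightarrow>
           (u, w) \<in> regular_normal_cone (gph F) (x, y) \<Longrightarrow> norm w \<le> c * norm u"
    using assms(1) unfolding regular_normals_bounded_at_infinity_def by metis
  obtain xs ys \<xi>s where gr: "\<And>k::nat. (xs k, ys k) \<in> gph F"
    and nc: "\<And>k. \<xi>s k \<in> regular_normal_cone (gph F) (xs k, ys k)"
    and lim: "filterlim (\<lambda>k. norm (xs k)) at_top sequentially" "ys \<longlonglongrightarrow> ybar" "\<xi>s \<longlonglongrightarrow> (0, w)"
    using assms(2) unfolding normal_cone_at_infinity_def by blast
  have "\<forall>\<^sub>F k in sequentially. norm (xs k) > R"
    using lim(1) by (simp add: filterlim_at_top_dense)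
  moreover have "\<forall>\<^sub>F k in sequentially. dist (ys k) ybar < \<delta>"
    using lim(2) *(1) by (rule tendstoD)
  ultimately have "\<forall>\<^sub>F k in sequentially. norm (snd (\<xi>s k)) \<le> c * norm (fst (\<xi>s k))"
  proof eventually_elim
    case (elim k)
    then show ?case using bd[of "ys k" "xs k" "fst (\<xi>s k)" "snd (\<xi>s k)"] gr[of k] nc[of k]
      by (auto simp: gph_def)
  qed
  moreover have "(\<lambda>k. norm (snd (\<xi>s k))) \<longlonglongrightarrow> norm w"
    using tendsto_norm[OF tendsto_snd[OF lim(3)]] by simp
  moreover have "(\<lambda>k. c * norm (fst (\<xi>s k))) \<longlonglongrightarrow> c * 0"
    using tendsto_mult_left[OF tendsto_norm[OF tendsto_fst[OF lim(3)]], of c] by simp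
  ultimately have "norm w \<le> c * 0"
    by (intro tendsto_le[OF sequentially_bot, of "\<lambda>k. c * norm (fst (\<xi>s k))"]) auto
  then show "w = 0" by simp
qed

text \<open>Failure of the estimate with constant \<open>n\<close> at points beyond radius \<open>n\<close> produces normals that,
  scaled to \<open>norm w = 1\<close>, have \<open>norm u \<le> 1 / n\<close>; compactness of the unit sphere then yields a
  normal at infinity \<open>(0, w)\<close> with \<open>norm w = 1\<close>.\<close>

lemma regular_normals_bounded_if_ker_coderivative_zero:
  fixes F :: "'a::real_inner \<Rightarrow> 'b::euclidean_space set"
  assumes ker: "\<And>w. (0, w) \<in> normal_cone_at_infinity (gph F) ybar \<Longrightarrow> w = 0"
  shows "regular_normals_bounded_at_infinity F ybar"
proof (rule ccontr)
  assume neg: "\<not> ?thesis"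
  have "\<exists>x y u w. y \<in> F x \<and> norm x > real (Suc n) \<and> dist y ybar < inverse (real (Suc n)) \<and>
      (u, w) \<in> regular_normal_cone (gph F) (x, y) \<and> norm w > real (Suc n) * norm u" for n
  proof -
    \<comment> \<open>The same number serves as radius, as constant and, inverted, as distance to \<open>ybar\<close>.\<close>
    define R where "R = real (Suc n)"
    have "R > 0" "inverse R > 0" by (auto simp: R_def)
    with neg show ?thesis
      unfolding regular_normals_bounded_at_infinity_def R_def[symmetric] by (meson not_le)
  qed
  then obtain xs ys us ws where gr: "\<And>n. ys n \<in> F (xs n)" and
    xs: "\<And>n. norm (xs n) > real (Suc n)" and ys: "\<And>n. dist (ys n) ybar < inverse (real (Suc n))" and
    nc: "\<And>n. (us n, ws n) \<in> regular_normal_cone (gph F) (xs n, ys n)" and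
    big: "\<And>n. norm (ws n) > real (Suc n) * norm (us n)"
    by metis
  have wpos: "norm (ws n) > 0" for n
    by (rule le_less_trans[OF _ big[of n]]) simp
  define \<eta>s where "\<eta>s = (\<lambda>n. us n /\<^sub>R norm (ws n))"
  define \<omega>s where "\<omega>s = (\<lambda>n. ws n /\<^sub>R norm (ws n))"
  have "\<omega>s n \<in> sphere 0 1" for n using wpos[of n] by (auto simp: \<omega>s_def)
  then obtain w r where w: "w \<in> sphere 0 1" "strict_mono (r :: nat \<Rightarrow> nat)" "(\<omega>s \<circ> r) \<longlonglongrightarrow> w"
    using seq_compactE[OF compact_imp_seq_compact[OF compact_sphere[of "0 :: 'b" 1]], of \<omega>s]
    by blast
  have inv0: "(\<lambda>n. inverse (real (Suc n))) \<longlonglongrightarrow> 0" by (rule LIMSEQ_inverse_real_of_nat)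
  have "norm (\<eta>s n) \<le> inverse (real (Suc n))" for n
    using big[of n] wpos[of n] by (simp add: \<eta>s_def field_simps)
  then have "\<eta>s \<longlonglongrightarrow> 0" by (intro Lim_null_comparison[OF _ inv0]) auto
  then have \<eta>: "(\<eta>s \<circ> r) \<longlonglongrightarrow> 0" using w(2) by (rule LIMSEQ_subseq_LIMSEQ)
  have "(\<lambda>n. dist (ys n) ybar) \<longlonglongrightarrow> 0"
  proof (rule Lim_null_comparison[OF _ inv0], rule always_eventually, rule allI)
    show "norm (dist (ys n) ybar) \<le> inverse (real (Suc n))" for n
      using less_imp_le[OF ys[of n]] by simp
  qed
  then have "ys \<longlonglongrightarrow> ybar" by (rule tendsto_dist_iff[THEN iffD2])
  then have y: "(ys \<circ> r) \<longlonglongrightarrow> ybar" using w(2) by (rule LIMSEQ_subseq_LIMSEQ)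
  have "filterlim (\<lambda>n. norm (xs n)) at_top sequentially"
  proof (rule filterlim_at_top_mono[OF filterlim_real_sequentially])
    show "\<forall>\<^sub>F n in sequentially. real n \<le> norm (xs n)"
    proof (rule always_eventually, rule allI)
      show "real n \<le> norm (xs n)" for n using xs[of n] by simp
    qed
  qed
  then have x: "filterlim (\<lambda>n. norm ((xs \<circ> r) n)) at_top sequentially"
    unfolding o_def by (rule filterlim_compose[OF _ filterlim_subseq[OF w(2)]])
  have "(\<eta>s n, \<omega>s n) \<in> regular_normal_cone (gph F) (xs n, ys n)" for n
    using scaleR_in_regular_normal_cone[OF nc[of n], of "inverse (norm (ws n))"]
    by (simp add: \<eta>s_def \<omega>s_def)
  moreover have "(\<lambda>n. ((\<eta>s \<circ> r) n, (\<omega>s \<circ> r) n)) \<longlonglongrightarrow> (0, w)"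
    using \<eta> w(3) by (rule tendsto_Pair)
  ultimately have "(0, w) \<in> normal_cone_at_infinity (gph F) ybar"
    unfolding normal_cone_at_infinity_def using x y gr
    by (intro CollectI exI[of _ "xs \<circ> r"] exI[of _ "ys \<circ> r"]
          exI[of _ "\<lambda>n. ((\<eta>s \<circ> r) n, (\<omega>s \<circ> r) n)"]) (auto simp: gph_def)
  then show False using ker w(1) by fastforce
qed

text \<open>For a regular normal \<open>(u, w)\<close> at \<open>(x, y)\<close>, moving \<open>y\<close> to \<open>y + t w\<close> is answered by a motion of
  \<open>x\<close> of length at most \<open>l t (norm w)\<close>.  The normal inequality along this motion compares
  \<open>t (norm w)\<^sup>2\<close> with \<open>l t (norm u) (norm w)\<close> up to an error of smaller order in \<open>t\<close>, so the
  constant of the estimate can be taken to be \<open>l\<close>.\<close>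

lemma regular_normals_bounded_if_inverse_Lipschitz_like:
  fixes F :: "'a::real_inner \<Rightarrow> 'b::real_inner set"
  assumes "inverse_Lipschitz_like_at_infinity F ybar"
  shows "regular_normals_bounded_at_infinity F ybar"
proof -
  obtain R l \<delta> where *: "R > 0" "l > 0" "\<delta> > 0"
    and P: "\<And>x y y'. norm x > R \<Longrightarrow> y' \<in> F x \<Longrightarrow> dist y' ybar < \<delta> \<Longrightarrow> dist y ybar < \<delta> \<Longrightarrow>
           (\<exists>x'. y \<in> F x' \<and> dist x x' \<le> l * dist y' y)"
    using assms unfolding inverse_Lipschitz_like_at_infinity_iff_ball by metis
  have "norm w \<le> l * norm u"
    if y: "y \<in> F x" "dist y ybar < \<delta>" and x: "norm x > R"
      and nc: "(u, w) \<in> regular_normal_cone (gph F) (x, y)" for x y u w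
  proof (cases "w = 0")
    case True
    then show ?thesis using *(2) by simp
  next
    case False
    then have w: "norm w > 0" by simp
    have "norm w \<le> l * norm u + e" if "e > 0" for e
    proof -
      define e' where "e' = e / (l + 1)"
      have e': "e' > 0" "e' * (l + 1) = e" using \<open>e > 0\<close> *(2) by (auto simp: e'_def)
      obtain d where d: "d > 0" "\<And>z'. z' \<in> gph F \<Longrightarrow> dist z' (x, y) < d \<Longrightarrow>
          (u, w) \<bullet> (z' - (x, y)) \<le> e' * norm (z' - (x, y))"
        using regular_normal_cone_le[OF nc e'(1)] by blast
      \<comment> \<open>The length \<open>s\<close> of the motion must stay in the ball around \<open>ybar\<close> and, together with the
        answering motion, in the neighbourhood where the normal inequality holds.\<close>
      define s where "s = min ((\<delta> - dist y ybar) / 2) (d / (2 * (l + 1)))"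
      have s: "s > 0" "s < \<delta> - dist y ybar" "s \<le> d / (2 * (l + 1))"
        using y(2) d(1) *(2) by (auto simp: s_def min_less_iff_disj)
      have sd: "(l + 1) * s < d"
      proof -
        have "(l + 1) * s \<le> d / 2" using s(3) *(2) by (simp add: field_simps)
        then show ?thesis using d(1) by simp
      qed
      define t where "t = s / norm w"
      have t: "t > 0" "t * norm w = s" using s(1) w by (auto simp: t_def)
      define y' where "y' = y + t *\<^sub>R w"
      have yy': "dist y y' = s" using t by (simp add: y'_def dist_norm)
      have "dist y' ybar < \<delta>" using dist_triangle[of y' ybar y] yy' s(2) by (simp add: dist_commute)
      then obtain x' where x': "y' \<in> F x'" "dist x x' \<le> l * s"
        using P[OF x y(1) y(2), of y'] yy' by auto
      have n: "norm ((x', y') - (x, y)) \<le> (l + 1) * s"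
      proof -
        have "norm ((x', y') - (x, y)) \<le> norm (x' - x) + norm (y' - y)"
          by (simp add: norm_Pair_le)
        also have "\<dots> \<le> l * s + s"
          using x'(2) yy' by (simp add: dist_norm norm_minus_commute)
        finally show ?thesis by (simp add: algebra_simps)
      qed
      have "(u, w) \<bullet> ((x', y') - (x, y)) \<le> e' * norm ((x', y') - (x, y))"
        using x'(1) n sd by (intro d(2)) (auto simp: gph_def dist_norm)
      also have "\<dots> \<le> e' * ((l + 1) * s)" using n e'(1) by (intro mult_left_mono) auto
      also have "\<dots> = e * s" using e'(2) by (simp add: mult.assoc[symmetric])
      finally have "u \<bullet> (x' - x) + t * (norm w)\<^sup>2 \<le> e * s"
        by (simp add: y'_def power2_norm_eq_inner)
      moreover have "t * (norm w)\<^sup>2 = s * norm w" using t(2) by (simp add: power2_eq_square)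
      moreover have "- (u \<bullet> (x' - x)) \<le> norm u * (l * s)"
      proof -
        have "- (u \<bullet> (x' - x)) \<le> norm u * norm (x' - x)"
          using norm_cauchy_schwarz[of u "x - x'"] by (simp add: inner_diff_right norm_minus_commute)
        also have "\<dots> \<le> norm u * (l * s)"
          using x'(2) by (intro mult_left_mono) (auto simp: dist_norm norm_minus_commute)
        finally show ?thesis .
      qed
      ultimately have "s * norm w \<le> s * (l * norm u + e)" by (simp add: algebra_simps)
      then show ?thesis using s(1) by simp
    qed
    then show ?thesis by (rule field_le_epsilon)
  qed
  then show ?thesis unfolding regular_normals_bounded_at_infinity_def using * by blast
qed

section \<open>From the estimate to the inverse Lipschitz-like property\<close>

text \<open>The part of \<open>\<Omega>\<close> in the box \<open>cball x \<rho> \<times> cball y s\<close> is compact.  With the weight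
  \<open>s / \<rho>\<^sup>2\<close>, every point outside the box costs at least \<open>s\<close>, which is the cost of the starting point
  \<open>(x, y')\<close>, so a minimiser over the box is a minimiser over all of \<open>\<Omega>\<close>.\<close>

lemma penalised_distance_attains_min:
  fixes x :: "'a::euclidean_space" and y :: "'b::euclidean_space"
  assumes "closed \<Omega>" and "(x, y') \<in> \<Omega>" and "\<rho> > 0" and s: "s = dist y' y" "s > 0"
  obtains a b where "(a, b) \<in> \<Omega>" "dist a x \<le> \<rho>" "dist b y \<le> s"
    "\<And>z. z \<in> \<Omega> \<Longrightarrow> dist b y + s / \<rho>\<^sup>2 * (dist a x)\<^sup>2 \<le> dist (snd z) y + s / \<rho>\<^sup>2 * (dist (fst z) x)\<^sup>2"
proof -
  define \<phi> where "\<phi> = (\<lambda>z. dist (snd z) y + s / \<rho>\<^sup>2 * (dist (fst z) x)\<^sup>2)"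
  define K where "K = \<Omega> \<inter> (cball x \<rho> \<times> cball y s)"
  have "compact K" unfolding K_def
    using assms(1) by (intro closed_Int_compact compact_Times compact_cball)
  moreover have xy': "(x, y') \<in> K" using assms by (auto simp: K_def dist_commute)
  moreover have "continuous_on K \<phi>" unfolding \<phi>_def by (intro continuous_intros)
  ultimately obtain p where p: "p \<in> K" "\<And>z. z \<in> K \<Longrightarrow> \<phi> p \<le> \<phi> z"
    using continuous_attains_inf[of K \<phi>] by blast
  have ps: "\<phi> p \<le> s" using p(2)[OF xy'] by (simp add: \<phi>_def s)
  have "\<phi> p \<le> \<phi> z" if "z \<in> \<Omega>" for z
  proof (cases "z \<in> K")
    case False
    with that consider "dist (fst z) x > \<rho>" | "dist (snd z) y > s"
      by (cases z) (auto simp: K_def dist_commute not_le)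
    then have "\<phi> z \<ge> s"
    proof cases
      case 1
      then have "\<rho>\<^sup>2 \<le> (dist (fst z) x)\<^sup>2" using assms(3) by (intro power_mono) auto
      then have "s / \<rho>\<^sup>2 * \<rho>\<^sup>2 \<le> s / \<rho>\<^sup>2 * (dist (fst z) x)\<^sup>2"
        using s(2) by (intro mult_left_mono) auto
      then show ?thesis using assms(3) by (simp add: \<phi>_def add_increasing)
    next
      case 2
      then show ?thesis using s(2) by (simp add: \<phi>_def add_increasing2)
    qed
    then show ?thesis using ps by simp
  qed (use p in auto)
  then show thesis using that[of "fst p" "snd p"] p(1)
    by (auto simp: K_def \<phi>_def dist_commute)
qed

lemma has_derivative_penalised_distance:
  fixes x :: "'a::real_inner" and y :: "'b::real_inner"
  assumes "b \<noteq> y"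
  shows "((\<lambda>z. dist (snd z) y + \<alpha> * (dist (fst z) x)\<^sup>2) has_derivative
    (\<lambda>v. ((2 * \<alpha>) *\<^sub>R (a - x), sgn (b - y)) \<bullet> v)) (at (a, b))"
proof -
  have "((\<lambda>z. snd z - y) has_derivative snd) (at (a, b))"
    by (auto intro!: derivative_eq_intros)
  moreover have "(norm has_derivative (\<lambda>h. h \<bullet> sgn (b - y))) (at (snd (a, b) - y))"
    using has_derivative_norm[of "b - y"] assms by simp
  ultimately have 1: "((\<lambda>z. norm (snd z - y)) has_derivative (\<lambda>v. snd v \<bullet> sgn (b - y)))
      (at (a, b))"
    by (rule has_derivative_compose)
  have 2: "((\<lambda>z. \<alpha> * ((fst z - x) \<bullet> (fst z - x))) has_derivative
      (\<lambda>v. \<alpha> * (2 * ((a - x) \<bullet> fst v)))) (at (a, b))"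
    by (auto intro!: derivative_eq_intros simp: inner_commute)
  show ?thesis
    using has_derivative_add[OF 1 2]
    by (simp add: dist_norm power2_norm_eq_inner inner_prod_def inner_commute algebra_simps)
qed

text \<open>The box radius \<open>4 c s\<close> balances two requirements.  It gives the Lipschitz constant \<open>4 c\<close>, and
  it makes the first component of the normal at a minimiser \<open>(a, b)\<close> with \<open>b \<noteq> y\<close> so short, namely
  of norm at most \<open>1 / (2 c)\<close>, that the estimate contradicts the second component having norm
  \<open>1\<close>.\<close>

lemma inverse_Lipschitz_like_if_regular_normals_bounded:
  fixes F :: "'a::euclidean_space \<Rightarrow> 'b::euclidean_space set"
  assumes cl: "closed (gph F)" and "regular_normals_bounded_at_infinity F ybar"
  shows "inverse_Lipschitz_like_at_infinity F ybar"
proof -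
  obtain R c \<delta> where *: "R > 0" "c > 0" "\<delta> > 0"
    and bd: "\<And>x y u w. y \<in> F x \<Longrightarrow> norm x > R \<Longrightarrow> dist y ybar < \<delta> \<Longrightarrow>
           (u, w) \<in> regular_normal_cone (gph F) (x, y) \<Longrightarrow> norm w \<le> c * norm u"
    using assms(2) unfolding regular_normals_bounded_at_infinity_def by metis
  \<comment> \<open>The smaller regions keep the minimiser where the estimate applies: it lies within
    \<open>4 * c * \<delta>\<close> of \<open>x\<close>, and its second component within \<open>2 * \<delta> / 3\<close> of \<open>y\<close>.\<close>
  have "\<exists>x'. y \<in> F x' \<and> dist x x' \<le> 4 * c * dist y' y"
    if x: "norm x > R + 4 * c * \<delta>" and y': "y' \<in> F x" "dist y' ybar < \<delta> / 3"
      and y: "dist y ybar < \<delta> / 3" for x y y'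
  proof (cases "y' = y")
    case True
    then show ?thesis using y' by (intro exI[of _ x]) auto
  next
    case False
    define s where "s = dist y' y"
    have s: "s > 0" using False by (simp add: s_def)
    have s_lt: "s < 2 * \<delta> / 3"
      using dist_triangle2[of y' y ybar] y y' by (simp add: s_def)
    define \<rho> where "\<rho> = 4 * c * s"
    have \<rho>: "\<rho> > 0" using s *(2) by (simp add: \<rho>_def)
    obtain a b where ab: "(a, b) \<in> gph F" "dist a x \<le> \<rho>" "dist b y \<le> s"
      and min: "\<And>z. z \<in> gph F \<Longrightarrow>
        dist b y + s / \<rho>\<^sup>2 * (dist a x)\<^sup>2 \<le> dist (snd z) y + s / \<rho>\<^sup>2 * (dist (fst z) x)\<^sup>2"
      using penalised_distance_attains_min[OF cl _ \<rho> s_def s, of x] y'(1)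
      by (auto simp: gph_def)
    have "b = y"
    proof (rule ccontr)
      assume "b \<noteq> y"
      have "- ((2 * (s / \<rho>\<^sup>2)) *\<^sub>R (a - x), sgn (b - y)) \<in> regular_normal_cone (gph F) (a, b)"
        by (rule minus_gradient_in_regular_normal_cone
            [OF has_derivative_penalised_distance[OF \<open>b \<noteq> y\<close>, of "s / \<rho>\<^sup>2" x]])
           (use min in auto)
      moreover have "norm a > R"
      proof -
        have "norm x \<le> norm a + dist a x" using norm_triangle_sub[of x a]
          by (simp add: dist_norm norm_minus_commute)
        moreover have "\<rho> \<le> 4 * c * \<delta>" unfolding \<rho>_def
          using s_lt *(2,3) by (intro mult_left_mono) auto
        ultimately show ?thesis using x ab(2) by linarith
      qed
      moreover have "dist b ybar < \<delta>"
        using dist_triangle[of b ybar y] ab(3) s_lt y by linarith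
      ultimately have "norm (- sgn (b - y)) \<le> c * norm (- ((2 * (s / \<rho>\<^sup>2)) *\<^sub>R (a - x)))"
        using ab(1) by (intro bd[of b a]) (auto simp: gph_def)
      then have "1 \<le> c * (2 * (s / \<rho>\<^sup>2) * dist a x)"
        using \<open>b \<noteq> y\<close> s by (simp add: norm_sgn dist_norm)
      also have "\<dots> \<le> c * (2 * (s / \<rho>\<^sup>2) * \<rho>)"
        using ab(2) *(2) s by (intro mult_left_mono) auto
      also have "\<dots> = 1 / 2" using \<rho> s *(2) by (simp add: \<rho>_def power2_eq_square field_simps)
      finally show False by simp
    qed
    then show ?thesis using ab(1,2) by (auto simp: gph_def \<rho>_def s_def dist_commute)
  qed
  then show ?thesis unfolding inverse_Lipschitz_like_at_infinity_iff_ball using *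
    by (intro exI[of _ "R + 4 * c * \<delta>"] exI[of _ "4 * c"] exI[of _ "\<delta> / 3"])
       (auto intro: add_pos_pos)
qed

section \<open>The equivalence\<close>

theorem theorem4p1:
  fixes F :: "real ^ 'n \<Rightarrow> (real ^ 'm) set" and ybar :: "real ^ 'm"
  assumes "closed (gph F)"
    and "ybar \<in> jelonek_set F"
  shows "(ker (coderivative_at_infinity F ybar) = {0} \<longleftrightarrow> linearly_open_at_infinity F ybar) \<and>
    (linearly_open_at_infinity F ybar \<longleftrightarrow> metrically_regular_at_infinity F ybar) \<and>
    (metrically_regular_at_infinity F ybar \<longleftrightarrow> inverse_Lipschitz_like_at_infinity F ybar)"
proof -
  have "ker (coderivative_at_infinity F ybar) = {0} \<longleftrightarrow>
      regular_normals_bounded_at_infinity F ybar"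
    unfolding ker_coderivative_eq_zero_iff[OF assms(2)]
    using regular_normals_bounded_if_ker_coderivative_zero
      ker_coderivative_zero_if_regular_normals_bounded by blast
  also have "\<dots> \<longleftrightarrow> inverse_Lipschitz_like_at_infinity F ybar"
    using inverse_Lipschitz_like_if_regular_normals_bounded[OF assms(1)]
      regular_normals_bounded_if_inverse_Lipschitz_like by blast
  finally show ?thesis
    using linearly_open_iff_inverse_Lipschitz_like
      metrically_regular_iff_inverse_Lipschitz_like[OF assms(1)] by blast
qed

end
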